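(* Let $\kappa,\lambda,\mu,\nu>0$ be real numbers. If the sides $BC,CD,DA,AB$ of a (nondegenerate) parallelogram $ABCD$ are divided at $K,L,M,N$ in the respective ratios $\kappa:1$, $\lambda:1$, $\mu:1$, $\nu:1$, then the cevians $AK,BL,CM,DN$ form a quadrilateral whose area is $$\frac{1}{2}\,\frac{\left(\frac{\mu}{1+\nu}+\frac{1+\mu}{\lambda}\right)\left(1+\frac{\kappa}{1+\mu}+\frac{\kappa+1}{\nu(1+\mu)}\right)}{\left(2+\frac{1}{\lambda}-\frac{1}{1+\mu}\right)\left(1+\mu+\frac{\nu\mu}{1+\nu}\right)\left(1+2\kappa+\frac{\kappa+1}{\nu}\right)} +\frac{1}{2}\,\frac{\left(\frac{\kappa+1}{\nu}+\frac{\kappa}{1+\lambda}\right)\left(1+\frac{1}{\lambda}+\frac{\kappa}{1+\mu}\right)}{\left(2+\frac{1}{\lambda}-\frac{1}{1+\mu}\right)\left(1+\kappa+\frac{\lambda\kappa}{1+\lambda}\right)\left(1+2\kappa+\frac{\kappa+1}{\nu}\right)}$$ times the area of $ABCD$.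
   Context: The ratios mean that $K,L,M,N$ lie on the segments $BC,CD,DA,AB$ respectively with $|BK|:|KC|=\kappa:1$, $|CL|:|LD|=\lambda:1$, $|DM|:|MA|=\mu:1$, $|AN|:|NB|=\nu:1$. The quadrilateral formed by the cevians is $XYZW$, with vertices in this order, where $X=BL\cap CM$, $Y=CM\cap DN$, $Z=DN\cap AK$, $W=AK\cap BL$. *)

theory Defs
  imports "HOL-Analysis.Analysis"
begin

definition divides_in_ratio :: "real^2 \<Rightarrow> real^2 \<Rightarrow> real^2 \<Rightarrow> real \<Rightarrow> bool" where
  "divides_in_ratio P U V r \<longleftrightarrow> P \<in> closed_segment U V \<and> dist U P = r * dist P V"

definition quad_path :: "real^2 \<Rightarrow> real^2 \<Rightarrow> real^2 \<Rightarrow> real^2 \<Rightarrow> real \<Rightarrow> real^2" where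
  "quad_path P Q R S = linepath P Q +++ linepath Q R +++ linepath R S +++ linepath S P"

text \<open>A nondegenerate, not necessarily convex, quadrilateral with vertices in the given cyclic
  order: its boundary does not cross itself and every vertex is a genuine corner.\<close>

definition quadrilateral :: "real^2 \<Rightarrow> real^2 \<Rightarrow> real^2 \<Rightarrow> real^2 \<Rightarrow> bool" where
  "quadrilateral P Q R S \<longleftrightarrow> simple_path (quad_path P Q R S) \<and>
     \<not> collinear {P, Q, R} \<and> \<not> collinear {Q, R, S} \<and>
     \<not> collinear {R, S, P} \<and> \<not> collinear {S, P, Q}"

definition quad_region :: "real^2 \<Rightarrow> real^2 \<Rightarrow> real^2 \<Rightarrow> real^2 \<Rightarrow> (real^2) set" where
  "quad_region P Q R S =
     path_image (quad_path P Q R S) \<union> inside (path_image (quad_path P Q R S))"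

definition quad_area :: "real^2 \<Rightarrow> real^2 \<Rightarrow> real^2 \<Rightarrow> real^2 \<Rightarrow> real" where
  "quad_area P Q R S = measure lebesgue (quad_region P Q R S)"

text \<open>Collinearity of two vectors with the origin expresses that they are parallel.\<close>

definition parallelogram :: "real^2 \<Rightarrow> real^2 \<Rightarrow> real^2 \<Rightarrow> real^2 \<Rightarrow> bool" where
  "parallelogram A B C D \<longleftrightarrow> quadrilateral A B C D \<and>
     collinear {0, B - A, C - D} \<and> collinear {0, C - B, D - A}"

end

theory Submission
  imports Defs
begin

text \<open>A quadrilateral all of whose corners turn in the same direction is the intersection of the
  four half-planes given by its sides; hence its boundary is simple, and a diagonal cuts it into
  two triangles whose areas add up. With \<open>b = B - A\<close>, \<open>d = D - A\<close> and
  \<open>k = \<kappa> / (1 + \<kappa>)\<close>, \<open>l = \<lambda> / (1 + \<lambda>)\<close> and so on, the crossing points of the cevians are explicit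
  affine combinations. Two consecutive sides of \<open>XYZW\<close> are multiples of the directions of two
  cevians, so the signed area of each corner triangle is a product of positive factors
  times the signed area of the parallelogram. The two summands of the formula are the corner
  triangles \<open>XYZ\<close> and \<open>ZWX\<close>.\<close>

section \<open>Signed areas, collinearity and half-planes\<close>

text \<open>Twice the signed area of the triangle, positive when it is counterclockwise. With
  \<open>P\<close> and \<open>Q\<close> fixed it is affine in \<open>R\<close>, and its sign tells
  the side of the line \<open>P Q\<close>.\<close>

definition orient :: "real^2 \<Rightarrow> real^2 \<Rightarrow> real^2 \<Rightarrow> real" where
  "orient P Q R = (Q$1 - P$1) * (R$2 - P$2) - (Q$2 - P$2) * (R$1 - P$1)"

lemma orient_rotate: "orient P Q R = orient Q R P"
  unfolding orient_def by (simp add: algebra_simps)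

lemma orient_refl [simp]: "orient P Q P = 0" "orient P Q Q = 0" "orient P P Q = 0"
  unfolding orient_def by simp_all

lemma orient_convex_comb:
  "orient P Q ((1 - t) *\<^sub>R x + t *\<^sub>R y) = (1 - t) * orient P Q x + t * orient P Q y"
  unfolding orient_def by (simp add: algebra_simps)

lemma collinear_iff_orient: "collinear {P, Q, R} \<longleftrightarrow> orient P Q R = 0"
proof
  assume "collinear {P, Q, R}"
  then consider "P = R" | u where "Q = u *\<^sub>R P + (1 - u) *\<^sub>R R"
    by (auto simp: collinear_3_expand)
  then show "orient P Q R = 0"
  proof cases
    case 2
    show ?thesis unfolding 2 by (simp add: orient_def algebra_simps)
  qed simp
next
  assume 0: "orient P Q R = 0"
  show "collinear {P, Q, R}"
  proof (cases "P = R")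
    case False
    then consider "P$1 \<noteq> R$1" | "P$2 \<noteq> R$2"
      by (auto simp: vec_eq_iff forall_2)
    then obtain u where "Q = u *\<^sub>R P + (1 - u) *\<^sub>R R"
    proof cases
      case 1
      \<comment> \<open>\<open>u\<close> is read off in a coordinate where \<open>P\<close> and
        \<open>R\<close> differ; the vanishing determinant forces the same \<open>u\<close> in the
        other coordinate.\<close>
      define u where "u = (Q$1 - R$1) / (P$1 - R$1)"
      have u: "Q$1 - R$1 = u * (P$1 - R$1)" using 1 by (simp add: u_def)
      then have "(P$1 - R$1) * (Q$2 - R$2) = (P$1 - R$1) * (u * (P$2 - R$2))"
        using 0 unfolding orient_def by algebra
      then have "Q$2 - R$2 = u * (P$2 - R$2)" using 1 by simp
      then have "Q = u *\<^sub>R P + (1 - u) *\<^sub>R R"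
        using u by (simp add: vec_eq_iff forall_2 algebra_simps)
      then show thesis by (rule that)
    next
      case 2
      define u where "u = (Q$2 - R$2) / (P$2 - R$2)"
      have u: "Q$2 - R$2 = u * (P$2 - R$2)" using 2 by (simp add: u_def)
      then have "(P$2 - R$2) * (Q$1 - R$1) = (P$2 - R$2) * (u * (P$1 - R$1))"
        using 0 unfolding orient_def by algebra
      then have "Q$1 - R$1 = u * (P$1 - R$1)" using 2 by simp
      then have "Q = u *\<^sub>R P + (1 - u) *\<^sub>R R"
        using u by (simp add: vec_eq_iff forall_2 algebra_simps)
      then show thesis by (rule that)
    qed
    then show ?thesis by (auto simp: collinear_3_expand)
  qed (simp add: collinear_3_expand)
qed

text \<open>Gives the signed area the form in which the known facts on half-spaces and hyperplanes
  apply. A point \<open>R\<close> off the line guarantees \<open>P \<noteq> Q\<close>, hence a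
  nonzero normal.\<close>

lemma orient_affine_functional:
  assumes "orient P Q R \<noteq> 0" "e \<noteq> 0"
  obtains a b where "a \<noteq> 0" "\<And>x. e * orient P Q x = a \<bullet> x - b"
proof
  \<comment> \<open>The vector from \<open>P\<close> to \<open>Q\<close>, turned by a right angle
    and scaled by \<open>e\<close>.\<close>
  define a :: "real^2" where "a = vector [- e * (Q$2 - P$2), e * (Q$1 - P$1)]"
  show "a \<noteq> 0"
    using assms by (auto simp: a_def orient_def vec_eq_iff forall_2)
  show "e * orient P Q x = a \<bullet> x - a \<bullet> P" for x
    by (simp add: a_def orient_def inner_vec_def sum_2 algebra_simps)
qed

lemma orient_halfplane:
  assumes "orient P Q R \<noteq> 0" "e \<noteq> 0"
  shows "interior {x. 0 \<le> e * orient P Q x} = {x. 0 < e * orient P Q x}"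
    and "negligible {x. orient P Q x = 0}"
proof -
  obtain a b where a: "a \<noteq> 0" and ab: "\<And>x. e * orient P Q x = a \<bullet> x - b"
    by (rule orient_affine_functional[OF assms]) blast
  show "interior {x. 0 \<le> e * orient P Q x} = {x. 0 < e * orient P Q x}"
    using interior_halfspace_ge[OF a, of b] by (simp add: ab)
  have "orient P Q x = 0 \<longleftrightarrow> a \<bullet> x = b" for x
    using ab[of x] \<open>e \<noteq> 0\<close> by auto
  then show "negligible {x. orient P Q x = 0}"
    using negligible_hyperplane[of a b] a by simp
qed

lemma orient_nonneg_on_segment:
  assumes "x \<in> closed_segment U V" "0 \<le> e * orient P Q U" "0 \<le> e * orient P Q V"
  shows "0 \<le> e * orient P Q x"
proof -
  obtain t where t: "0 \<le> t" "t \<le> 1" "x = (1 - t) *\<^sub>R U + t *\<^sub>R V"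
    using assms(1) by (auto simp: in_segment)
  have "e * orient P Q x = (1 - t) * (e * orient P Q U) + t * (e * orient P Q V)"
    unfolding t(3) orient_convex_comb by (simp add: algebra_simps)
  then show ?thesis using t assms by simp
qed

lemma orient_pos_on_segment:
  assumes "x \<in> closed_segment U V" "0 < e * orient P Q U" "0 < e * orient P Q V"
  shows "0 < e * orient P Q x"
proof -
  obtain t where t: "0 \<le> t" "t \<le> 1" "x = (1 - t) *\<^sub>R U + t *\<^sub>R V"
    using assms(1) by (auto simp: in_segment)
  have "e * orient P Q x = (1 - t) * (e * orient P Q U) + t * (e * orient P Q V)"
    unfolding t(3) orient_convex_comb by (simp add: algebra_simps)
  moreover have "0 < (1 - t) * (e * orient P Q U) + t * (e * orient P Q V)"
    using t assms(2,3) by (cases "t = 0") (auto intro!: add_nonneg_pos)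
  ultimately show ?thesis by simp
qed

lemma orient_zero_on_segment:
  assumes "x \<in> closed_segment P Q"
  shows "orient P Q x = 0"
proof -
  obtain t where t: "x = (1 - t) *\<^sub>R P + t *\<^sub>R Q"
    using assms by (auto simp: in_segment)
  then show ?thesis by (simp add: orient_convex_comb)
qed

section \<open>Convexly turning quadrilaterals have simple boundary\<close>

text \<open>The sign of the scalar \<open>e\<close> records the orientation of the quadrilateral, so that clockwise
  and counterclockwise ones are treated at once.\<close>

definition convex_quad :: "real \<Rightarrow> real^2 \<Rightarrow> real^2 \<Rightarrow> real^2 \<Rightarrow> real^2 \<Rightarrow> bool" where
  "convex_quad e P Q R S \<longleftrightarrow> 0 < e * orient P Q R \<and> 0 < e * orient Q R S \<and>
     0 < e * orient R S P \<and> 0 < e * orient S P Q"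

lemma convex_quad_rotate: "convex_quad e P Q R S \<Longrightarrow> convex_quad e Q R S P"
  by (simp add: convex_quad_def)

text \<open>\<open>P\<close> and \<open>Q\<close> lie strictly on the inner side of the line
  \<open>R S\<close>, so the whole side between them misses that line.\<close>

lemma convex_quad_opposite_sides:
  assumes "convex_quad e P Q R S"
  shows "closed_segment P Q \<inter> closed_segment R S = {}"
proof -
  have "0 < e * orient R S x" if "x \<in> closed_segment P Q" for x
    using that assms orient_rotate[of Q R S]
    by (intro orient_pos_on_segment[OF that]) (auto simp: convex_quad_def)
  then show ?thesis using orient_zero_on_segment[of _ R S] by force
qed

lemma convex_quad_adjacent_sides:
  assumes "convex_quad e P Q R S"
  shows "closed_segment P Q \<inter> closed_segment Q R = {Q}"
  using assms by (intro Int_closed_segment) (auto simp: convex_quad_def collinear_iff_orient)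

lemma path_image_quad_path:
  "path_image (quad_path P Q R S) =
     closed_segment P Q \<union> closed_segment Q R \<union> closed_segment R S \<union> closed_segment S P"
  by (simp add: quad_path_def path_image_join Un_assoc)

lemma convex_quad_imp_quadrilateral:
  assumes "convex_quad e P Q R S"
  shows "quadrilateral P Q R S"
proof -
  note r1 = convex_quad_rotate[OF assms]
  note r2 = convex_quad_rotate[OF r1]
  note r3 = convex_quad_rotate[OF r2]
  have neq: "P \<noteq> Q" "Q \<noteq> R" "R \<noteq> S" "S \<noteq> P"
    using assms by (auto simp: convex_quad_def)
  note sides = convex_quad_opposite_sides[OF assms] convex_quad_opposite_sides[OF r1]
    convex_quad_adjacent_sides[OF assms] convex_quad_adjacent_sides[OF r1]
    convex_quad_adjacent_sides[OF r2] convex_quad_adjacent_sides[OF r3]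
  \<comment> \<open>The loop is assembled from its last side backwards; each join needs only that
    the new side meets the rest in the intended endpoints, which \<open>sides\<close>
    provides.\<close>
  have "arc (linepath R S +++ linepath S P)"
    using neq sides by (intro arc_join) auto
  then have "arc (linepath Q R +++ linepath R S +++ linepath S P)"
    using neq sides by (intro arc_join) (auto simp: path_image_join)
  then have "simple_path (quad_path P Q R S)"
    unfolding quad_path_def using neq sides
    by (intro simple_path_join_loop) (auto simp: path_image_join)
  then show ?thesis
    using assms by (auto simp: quadrilateral_def collinear_iff_orient convex_quad_def)
qed

section \<open>The region of a convexly turning quadrilateral\<close>

text \<open>Half-planes make convexity and the interior easy to obtain; the description by two
  triangles, needed for compactness and area, is derived in
  \<open>quad_hull_eq_triangles\<close>.\<close>

definition quad_hull :: "real \<Rightarrow> real^2 \<Rightarrow> real^2 \<Rightarrow> real^2 \<Rightarrow> real^2 \<Rightarrow> (real^2) set" where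
  "quad_hull e P Q R S = {x. 0 \<le> e * orient P Q x} \<inter> {x. 0 \<le> e * orient Q R x} \<inter>
     {x. 0 \<le> e * orient R S x} \<inter> {x. 0 \<le> e * orient S P x}"

lemma quad_hull_rotate: "quad_hull e P Q R S = quad_hull e Q R S P"
  by (auto simp: quad_hull_def)

lemma quad_hull_convex: "convex (quad_hull e P Q R S)"
  by (auto simp: convex_contains_segment quad_hull_def intro: orient_nonneg_on_segment)

lemma quad_hull_vertices:
  assumes "convex_quad e P Q R S"
  shows "{P, Q, R, S} \<subseteq> quad_hull e P Q R S"
  using assms orient_rotate[of P Q R] orient_rotate[of Q R S] orient_rotate[of R S P]
    orient_rotate[of S P Q]
  by (simp add: quad_hull_def convex_quad_def)

text \<open>On the line, \<open>x = (1 - t) P + t Q\<close>. The half-plane of \<open>Q R\<close>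
  vanishes at \<open>Q\<close> and yields \<open>t \<le> 1\<close>; that of \<open>S P\<close>
  vanishes at \<open>P\<close> and yields \<open>0 \<le> t\<close>.\<close>

lemma quad_hull_inter_side:
  assumes "convex_quad e P Q R S" "x \<in> quad_hull e P Q R S" "orient P Q x = 0"
  shows "x \<in> closed_segment P Q"
proof -
  have pos: "0 < e * orient Q R P" "0 < e * orient S P Q"
    and nonneg: "0 \<le> e * orient Q R x" "0 \<le> e * orient S P x"
    using assms orient_rotate[of P Q R] by (simp_all add: convex_quad_def quad_hull_def)
  have "P \<noteq> Q" using pos by auto
  moreover have "collinear {P, x, Q}"
    using assms(3) by (simp add: collinear_iff_orient[symmetric] insert_commute)
  ultimately obtain u where "x = u *\<^sub>R P + (1 - u) *\<^sub>R Q"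
    by (auto simp: collinear_3_expand)
  then obtain t where x: "x = (1 - t) *\<^sub>R P + t *\<^sub>R Q"
    using that[of "1 - u"] by simp
  have "0 \<le> (1 - t) * (e * orient Q R P)" "0 \<le> t * (e * orient S P Q)"
    using nonneg unfolding x orient_convex_comb by (simp_all add: ac_simps)
  then have "0 \<le> t" "t \<le> 1" using pos by (simp_all add: zero_le_mult_iff)
  then show ?thesis by (auto simp: in_segment x)
qed

text \<open>The barycentric coordinates of \<open>x\<close> are the signed areas of the triangles it
  forms with the sides, divided by the whole area.\<close>

lemma triangle_hull:
  assumes "0 < e * orient P Q R"
    and "0 \<le> e * orient P Q x" "0 \<le> e * orient Q R x" "0 \<le> e * orient R P x"
  shows "x \<in> convex hull {P, Q, R}"
proof -
  define d where "d = e * orient P Q R"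
  define u v w where uvw: "u = e * orient Q R x / d" "v = e * orient R P x / d" "w = e * orient P Q x / d"
  have d: "d > 0" using assms(1) by (simp add: d_def)
  have "e * orient Q R x + e * orient R P x + e * orient P Q x = d"
    by (simp add: d_def orient_def algebra_simps)
  then have "u + v + w = 1"
    using d by (simp add: uvw add_divide_distrib[symmetric])
  moreover have "d *\<^sub>R x = (e * orient Q R x) *\<^sub>R P + (e * orient R P x) *\<^sub>R Q + (e * orient P Q x) *\<^sub>R R"
    by (simp add: vec_eq_iff forall_2 d_def orient_def algebra_simps)
  then have "(1/d) *\<^sub>R (d *\<^sub>R x) = u *\<^sub>R P + v *\<^sub>R Q + w *\<^sub>R R"
    by (simp add: uvw scaleR_add_right)
  then have "x = u *\<^sub>R P + v *\<^sub>R Q + w *\<^sub>R R"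
    using d by simp
  moreover have "0 \<le> u" "0 \<le> v" "0 \<le> w" using d assms by (simp_all add: uvw)
  ultimately show ?thesis unfolding convex_hull_3 by blast
qed

text \<open>The functional vanishes at \<open>P\<close> and \<open>Q\<close>, so its value at
  \<open>x\<close> is its value at \<open>R\<close> times the barycentric weight of
  \<open>R\<close>.\<close>

lemma triangle_hull_halfplane:
  assumes "x \<in> convex hull {P, Q, R}" "0 \<le> e * orient P Q R"
  shows "0 \<le> e * orient P Q x"
proof -
  obtain u v w where w: "0 \<le> w" "u + v + w = 1" and x: "x = u *\<^sub>R P + v *\<^sub>R Q + w *\<^sub>R R"
    using assms(1) unfolding convex_hull_3 by blast
  then have u: "u = 1 - v - w" by simp
  have "orient P Q x = w * orient P Q R"
    unfolding x u by (simp add: orient_def algebra_simps)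
  then have "e * orient P Q x = w * (e * orient P Q R)" by simp
  then show ?thesis using w(1) assms(2) by (simp only: mult_nonneg_nonneg)
qed

lemma quad_hull_eq_triangles:
  assumes "convex_quad e P Q R S"
  shows "quad_hull e P Q R S = convex hull {P, Q, R} \<union> convex hull {R, S, P}"
proof
  show "convex hull {P, Q, R} \<union> convex hull {R, S, P} \<subseteq> quad_hull e P Q R S"
    using quad_hull_vertices[OF assms] quad_hull_convex by (intro Un_least hull_minimal) auto
  show "quad_hull e P Q R S \<subseteq> convex hull {P, Q, R} \<union> convex hull {R, S, P}"
  proof
    fix x assume x: "x \<in> quad_hull e P Q R S"
    \<comment> \<open>Each point lies on one side of the diagonal \<open>P R\<close>; this
      half-plane and the two sides of the quadrilateral there bound one of the triangles.\<close>
    have "orient P R x = - orient R P x" by (simp add: orient_def algebra_simps)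
    then consider "0 \<le> e * orient R P x" | "0 \<le> e * orient P R x"
      by fastforce
    then show "x \<in> convex hull {P, Q, R} \<union> convex hull {R, S, P}"
      using x assms triangle_hull[of e P Q R x] triangle_hull[of e R S P x]
      by cases (auto simp: quad_hull_def convex_quad_def)
  qed
qed

lemma compact_quad_hull:
  assumes "convex_quad e P Q R S"
  shows "compact (quad_hull e P Q R S)"
  unfolding quad_hull_eq_triangles[OF assms]
  by (intro compact_Un compact_convex_hull finite_imp_compact) auto

text \<open>The interior is cut out by the strict inequalities, so a hull point is on the frontier
  iff one of the four signed areas vanishes, that is, iff it lies on a side.\<close>

lemma frontier_quad_hull:
  assumes "convex_quad e P Q R S"
  shows "frontier (quad_hull e P Q R S) = path_image (quad_path P Q R S)"
proof -
  let ?H = "quad_hull e P Q R S"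
  note r1 = convex_quad_rotate[OF assms]
  note r2 = convex_quad_rotate[OF r1]
  note r3 = convex_quad_rotate[OF r2]
  have ne: "e \<noteq> 0" "orient P Q R \<noteq> 0" "orient Q R S \<noteq> 0" "orient R S P \<noteq> 0" "orient S P Q \<noteq> 0"
    using assms by (auto simp: convex_quad_def)
  have "interior ?H = {x. 0 < e * orient P Q x} \<inter> {x. 0 < e * orient Q R x} \<inter>
     {x. 0 < e * orient R S x} \<inter> {x. 0 < e * orient S P x}"
    by (simp only: quad_hull_def interior_Int orient_halfplane(1)[OF ne(2,1)]
      orient_halfplane(1)[OF ne(3,1)] orient_halfplane(1)[OF ne(4,1)] orient_halfplane(1)[OF ne(5,1)])
  moreover have "frontier ?H = ?H - interior ?H"
    using compact_quad_hull[OF assms] by (simp add: frontier_def compact_imp_closed)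
  ultimately have fr: "frontier ?H = {x \<in> ?H. orient P Q x = 0 \<or> orient Q R x = 0 \<or>
      orient R S x = 0 \<or> orient S P x = 0}"
    using ne(1) by (force simp: quad_hull_def order.strict_iff_order)
  show ?thesis
  proof
    have "x \<in> path_image (quad_path P Q R S)" if "x \<in> frontier ?H" for x
    proof -
      have "x \<in> ?H" using that fr by simp
      then show ?thesis
        using that quad_hull_inter_side[OF assms, of x] quad_hull_inter_side[OF r1, of x]
          quad_hull_inter_side[OF r2, of x] quad_hull_inter_side[OF r3, of x]
        unfolding fr path_image_quad_path by (auto simp: quad_hull_def)
    qed
    then show "frontier ?H \<subseteq> path_image (quad_path P Q R S)" by blast
    have "path_image (quad_path P Q R S) \<subseteq> ?H"
      using quad_hull_vertices[OF assms] quad_hull_convex[of e P Q R S]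
      unfolding path_image_quad_path by (simp add: closed_segment_subset)
    moreover have "orient P Q x = 0 \<or> orient Q R x = 0 \<or> orient R S x = 0 \<or> orient S P x = 0"
      if "x \<in> path_image (quad_path P Q R S)" for x
      using that orient_zero_on_segment[of x] unfolding path_image_quad_path by blast
    ultimately show "path_image (quad_path P Q R S) \<subseteq> frontier ?H"
      unfolding fr by blast
  qed
qed

text \<open>The inside of the frontier of a bounded convex set is its interior; this links the
  topological region to the half-planes.\<close>

lemma quad_region_convex_quad:
  assumes "convex_quad e P Q R S"
  shows "quad_region P Q R S = quad_hull e P Q R S"
proof -
  have "inside (path_image (quad_path P Q R S)) = interior (quad_hull e P Q R S)"
    using compact_quad_hull[OF assms] quad_hull_convex
    by (simp add: frontier_quad_hull[OF assms, symmetric] inside_frontier_eq_interior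
      compact_imp_bounded)
  then show ?thesis
    using compact_quad_hull[OF assms] interior_subset
    by (auto simp: quad_region_def frontier_quad_hull[OF assms, symmetric] frontier_def
      compact_imp_closed)
qed

section \<open>Areas\<close>

lemma measure_triangle: "measure lebesgue (convex hull {P, Q, R}) = \<bar>orient P Q R\<bar> / 2"
proof -
  \<comment> \<open>\<open>content_triangle\<close> speaks of the Borel version of Lebesgue measure,
    which the completion extends.\<close>
  have "convex hull {P, Q, R} \<in> sets borel"
    by (intro borel_closed compact_imp_closed compact_convex_hull finite_imp_compact) auto
  then show ?thesis
    using content_triangle[of P Q R]
    by (simp add: orient_def measure_completion abs_minus_commute mult.commute)
qed

text \<open>The two triangles lie on opposite sides of the diagonal, so they overlap only in a null
  set and their areas add.\<close>

lemma quad_area_convex_quad: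
  assumes "convex_quad e P Q R S"
  shows "quad_area P Q R S = (\<bar>orient P Q R\<bar> + \<bar>orient R S P\<bar>) / 2"
proof -
  let ?T1 = "convex hull {P, Q, R}" and ?T2 = "convex hull {R, S, P}"
  have pos: "0 < e * orient R P Q" "0 < e * orient R S P" "e \<noteq> 0"
    using assms orient_rotate[of R P Q] by (auto simp: convex_quad_def)
  have "?T1 \<inter> ?T2 \<subseteq> {x. orient R P x = 0}"
  proof
    fix x assume x: "x \<in> ?T1 \<inter> ?T2"
    have "0 \<le> e * orient R P x"
      using x pos by (intro triangle_hull_halfplane[of x R P Q e]) (auto simp: insert_commute)
    moreover have "0 \<le> e * orient P R x"
      using x pos orient_rotate[of P R S]
      by (intro triangle_hull_halfplane[of x P R S e]) (auto simp: insert_commute)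
    moreover have "orient P R x = - orient R P x" by (simp add: orient_def algebra_simps)
    ultimately show "x \<in> {x. orient R P x = 0}" using pos(3) by simp
  qed
  moreover have "negligible {x. orient R P x = 0}"
    using pos by (intro orient_halfplane(2)[of R P Q e]) auto
  ultimately have "negligible (?T1 \<inter> ?T2)" by (rule negligible_subset[rotated])
  moreover have "?T1 \<in> lmeasurable" "?T2 \<in> lmeasurable"
    by (simp_all add: lmeasurable_compact compact_convex_hull finite_imp_compact)
  ultimately have "measure lebesgue (?T1 \<union> ?T2) = measure lebesgue ?T1 + measure lebesgue ?T2"
    by (simp add: measure_Un3 negligible_imp_measure0)
  then show ?thesis
    by (simp add: quad_area_def quad_region_convex_quad[OF assms] quad_hull_eq_triangles[OF assms]
      measure_triangle)
qed

section \<open>Division points and crossings of cevians\<close>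

lemma divides_in_ratio_eq:
  assumes "divides_in_ratio P U V r" "0 < r"
  shows "P = U + (r / (1 + r)) *\<^sub>R (V - U)"
proof (cases "U = V")
  case True
  then show ?thesis using assms by (simp add: divides_in_ratio_def)
next
  case False
  obtain t where t: "0 \<le> t" "t \<le> 1" "P = (1 - t) *\<^sub>R U + t *\<^sub>R V"
    using assms(1) by (auto simp: divides_in_ratio_def in_segment)
  have "P - U = t *\<^sub>R (V - U)" "V - P = (1 - t) *\<^sub>R (V - U)"
    by (simp_all add: t algebra_simps)
  then have "norm (P - U) = t * norm (V - U)" "norm (V - P) = (1 - t) * norm (V - U)"
    using t(1,2) by simp_all
  then have "dist U P = t * dist U V" "dist P V = (1 - t) * dist U V"
    by (simp_all add: dist_norm norm_minus_commute)
  then have "t * dist U V = r * (1 - t) * dist U V"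
    using assms(1) by (simp add: divides_in_ratio_def)
  then have "t = r * (1 - t)" using False by simp
  then have "t = r / (1 + r)" using assms(2) by (simp add: field_simps)
  then show ?thesis by (simp add: t algebra_simps)
qed

text \<open>The difference of two common points is parallel to both directions; elimination shows
  that the nonzero determinant annihilates each of its coordinates.\<close>

lemma segments_inter_singleton:
  assumes "X \<in> closed_segment U V" "X \<in> closed_segment U' V'"
    and "orient 0 (V - U) (V' - U') \<noteq> 0"
  shows "closed_segment U V \<inter> closed_segment U' V' = {X}"
proof -
  have "Y = X" if Y: "Y \<in> closed_segment U V" "Y \<in> closed_segment U' V'" for Y
  proof -
    note on = orient_zero_on_segment[OF assms(1)] orient_zero_on_segment[OF assms(2)]
      orient_zero_on_segment[OF Y(1)] orient_zero_on_segment[OF Y(2)]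
    have "orient 0 (V - U) (V' - U') * (Y$1 - X$1) = 0"
      using on unfolding orient_def vector_minus_component zero_index by algebra
    moreover have "orient 0 (V - U) (V' - U') * (Y$2 - X$2) = 0"
      using on unfolding orient_def vector_minus_component zero_index by algebra
    ultimately show ?thesis using assms(3) by (simp add: vec_eq_iff forall_2)
  qed
  then show ?thesis using assms(1,2) by blast
qed

text \<open>In the parallelogram with vertices \<open>A\<close>, \<open>B = A + b\<close>, \<open>C = A + b + d\<close>, \<open>D = A + d\<close> this is
  the intersection of \<open>AK\<close> and \<open>BL\<close>, where \<open>K = B + k d\<close> and \<open>L = C - l b\<close>. The other three
  crossings arise by advancing the base vertex and replacing \<open>(b, d)\<close> by \<open>(d, -b)\<close>.\<close>

definition crossing :: "real^2 \<Rightarrow> real^2 \<Rightarrow> real^2 \<Rightarrow> real \<Rightarrow> real \<Rightarrow> real^2" where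
  "crossing A b d k l = A + (1 / (1 + k * l)) *\<^sub>R (b + k *\<^sub>R d)"

lemma cevians_inter:
  assumes "orient 0 b d \<noteq> 0" "0 < k" "k < 1" "0 < l" "l < 1"
  shows "closed_segment A (A + b + k *\<^sub>R d) \<inter> closed_segment (A + b) (A + b + d - l *\<^sub>R b)
    = {crossing A b d k l}"
proof (rule segments_inter_singleton)
  have pos: "0 < 1 + k * l" using assms by (simp add: add_pos_pos)
  have "crossing A b d k l = (1 - 1 / (1 + k * l)) *\<^sub>R A + (1 / (1 + k * l)) *\<^sub>R (A + b + k *\<^sub>R d)"
    by (simp add: crossing_def algebra_simps)
  moreover have "0 \<le> 1 / (1 + k * l)" "1 / (1 + k * l) \<le> 1"
    using pos assms by simp_all
  ultimately show "crossing A b d k l \<in> closed_segment A (A + b + k *\<^sub>R d)"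
    unfolding in_segment by blast
  \<comment> \<open>The parameter on \<open>BL\<close>. Equating \<open>t (b + k d)\<close> with
    \<open>b + s (d - l b)\<close> gives \<open>t = 1 - s l\<close> and \<open>t k = s\<close>,
    hence \<open>t = 1 / (1 + k l)\<close> and \<open>s = k / (1 + k l)\<close>.\<close>
  define s where "s = k / (1 + k * l)"
  have s: "1 / (1 + k * l) = 1 - s * l" "k / (1 + k * l) = s"
    using pos by (simp_all add: s_def field_simps)
  have "crossing A b d k l = A + (1 / (1 + k * l)) *\<^sub>R b + (k / (1 + k * l)) *\<^sub>R d"
    by (simp add: crossing_def scaleR_add_right add.assoc)
  also have "\<dots> = (1 - s) *\<^sub>R (A + b) + s *\<^sub>R (A + b + d - l *\<^sub>R b)"
    unfolding s by (simp add: algebra_simps)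
  finally have "crossing A b d k l = (1 - s) *\<^sub>R (A + b) + s *\<^sub>R (A + b + d - l *\<^sub>R b)" .
  moreover have "k \<le> 1 + k * l" using assms by (simp add: add_increasing2)
  then have "0 \<le> s" "s \<le> 1"
    using pos assms by (simp_all add: s_def)
  ultimately show "crossing A b d k l \<in> closed_segment (A + b) (A + b + d - l *\<^sub>R b)"
    unfolding in_segment by blast
  have "orient 0 (A + b + k *\<^sub>R d - A) (A + b + d - l *\<^sub>R b - (A + b)) = (1 + k * l) * orient 0 b d"
    by (simp add: orient_def algebra_simps)
  then show "orient 0 (A + b + k *\<^sub>R d - A) (A + b + d - l *\<^sub>R b - (A + b)) \<noteq> 0"
    using pos assms by simp
qed

section \<open>Corner triangles of the inner quadrilateral\<close>

lemma orient_crossings: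
  assumes "0 < k" "0 < l" "0 < m" "0 < n"
  shows "orient (crossing A b d k l) (crossing (A + b) d (- b) l m) (crossing (A + b + d) (- b) (- d) m n)
    = (1 - k + k * l - k * l * m) * (1 - l + l * m - l * m * n)
        / ((1 + k * l) * (1 + l * m) * (1 + m * n)) * orient 0 b d"
proof -
  \<comment> \<open>The parameters of the three crossings \<open>W\<close>, \<open>X\<close>,
    \<open>Y\<close> along \<open>AK\<close>, \<open>BL\<close>, \<open>CM\<close>.\<close>
  define p q r where pqr: "p = 1 / (1 + k * l)" "q = 1 / (1 + l * m)" "r = 1 / (1 + m * n)"
  have "1 + k * l \<noteq> 0" "1 + l * m \<noteq> 0" "1 + m * n \<noteq> 0"
    using assms by (simp_all add: add_pos_pos less_imp_neq[symmetric])
  then have *: "p * (1 + k * l) = 1" "q * (1 + l * m) = 1" "r * (1 + m * n) = 1"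
    by (simp_all add: pqr)
  \<comment> \<open>On \<open>BL\<close> the crossing \<open>W\<close> has parameter
    \<open>p * k\<close> and \<open>X\<close> has \<open>q\<close>. Likewise on \<open>CM\<close>
    below, \<open>X\<close> has \<open>q * l\<close> and \<open>Y\<close> has
    \<open>r\<close>.\<close>
  have XW: "crossing (A + b) d (- b) l m - crossing A b d k l = (q - p * k) *\<^sub>R (d - l *\<^sub>R b)"
  proof -
    have "1 - q * l - p = (q - p * k) * - l" using * by algebra
    then have "(1 - q * l - p) *\<^sub>R b = ((q - p * k) * - l) *\<^sub>R b" by simp
    then show ?thesis by (simp add: crossing_def pqr[symmetric] algebra_simps)
  qed
  have YX: "crossing (A + b + d) (- b) (- d) m n - crossing (A + b) d (- b) l m
      = (r - q * l) *\<^sub>R (- b - m *\<^sub>R d)"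
  proof -
    have "1 - r * m - q = (r - q * l) * - m" using * by algebra
    then have "(1 - r * m - q) *\<^sub>R d = ((r - q * l) * - m) *\<^sub>R d" by simp
    then show ?thesis by (simp add: crossing_def pqr[symmetric] algebra_simps)
  qed
  have cr: "orient U V Y = orient 0 (V - U) (Y - V)" for U V Y
    by (simp add: orient_def algebra_simps)
  have "orient (crossing A b d k l) (crossing (A + b) d (- b) l m) (crossing (A + b + d) (- b) (- d) m n)
    = (q - p * k) * (r - q * l) * (1 + l * m) * orient 0 b d"
    unfolding cr[of "crossing A b d k l"] XW YX by (simp add: orient_def algebra_simps)
  moreover have "q - p * k = (1 - k + k * l - k * l * m) * (p * q)" using * by algebra
  moreover have "r - q * l = (1 - l + l * m - l * m * n) * (q * r)" using * by algebra
  \<comment> \<open>The determinant of the two directions contributes \<open>1 + l * m\<close>,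
    which cancels one of the two factors \<open>q\<close>.\<close>
  ultimately have "orient (crossing A b d k l) (crossing (A + b) d (- b) l m) (crossing (A + b + d) (- b) (- d) m n)
    = (1 - k + k * l - k * l * m) * (1 - l + l * m - l * m * n) * (p * q * r) * orient 0 b d"
    using *(2) by algebra
  then show ?thesis by (simp add: pqr)
qed

text \<open>By the two parallelisms \<open>C - (B + D - A)\<close> is parallel to both
  \<open>B - A\<close> and \<open>D - A\<close>, which are independent, so it is zero.\<close>

lemma parallelogram_opposite_vertex:
  assumes "parallelogram A B C D"
  shows "C = B + D - A" and "orient A B D \<noteq> 0"
proof -
  have nc: "orient A B C \<noteq> 0" "orient B C D \<noteq> 0" "orient C D A \<noteq> 0" "orient D A B \<noteq> 0"
    and par: "orient 0 (B - A) (C - D) = 0" "orient 0 (C - B) (D - A) = 0"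
    using assms by (simp_all add: parallelogram_def quadrilateral_def collinear_iff_orient)
  then show "orient A B D \<noteq> 0" using orient_rotate[of D A B] by simp
  have "orient D A B * (C$1 - (B$1 + D$1 - A$1)) = 0"
    using par unfolding orient_def vector_minus_component zero_index by algebra
  moreover have "orient D A B * (C$2 - (B$2 + D$2 - A$2)) = 0"
    using par unfolding orient_def vector_minus_component zero_index by algebra
  ultimately show "C = B + D - A" using nc(4) by (simp add: vec_eq_iff forall_2)
qed

section \<open>The stated formula in terms of the division parameters\<close>

lemma area_ratio:
  fixes \<kappa> lam \<mu> \<nu> :: real
  assumes "0 < \<kappa>" "0 < lam" "0 < \<mu>" "0 < \<nu>"
  defines "k \<equiv> \<kappa> / (1 + \<kappa>)" and "l \<equiv> lam / (1 + lam)" and "m \<equiv> \<mu> / (1 + \<mu>)" and "n \<equiv> \<nu> / (1 + \<nu>)"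
  shows "((\<mu> / (1 + \<nu>) + (1 + \<mu>) / lam) * (1 + \<kappa> / (1 + \<mu>) + (\<kappa> + 1) / (\<nu> * (1 + \<mu>))))
      / ((2 + 1 / lam - 1 / (1 + \<mu>)) * (1 + \<mu> + \<nu> * \<mu> / (1 + \<nu>)) * (1 + 2 * \<kappa> + (\<kappa> + 1) / \<nu>))
    = (1 - l + l * m - l * m * n) * (1 - m + m * n - m * n * k)
      / ((1 + l * m) * (1 + m * n) * (1 + n * k))" (is ?first)
    and "(((\<kappa> + 1) / \<nu> + \<kappa> / (1 + lam)) * (1 + 1 / lam + \<kappa> / (1 + \<mu>)))
      / ((2 + 1 / lam - 1 / (1 + \<mu>)) * (1 + \<kappa> + lam * \<kappa> / (1 + lam)) * (1 + 2 * \<kappa> + (\<kappa> + 1) / \<nu>))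
    = (1 - n + n * k - n * k * l) * (1 - k + k * l - k * l * m)
      / ((1 + n * k) * (1 + k * l) * (1 + l * m))" (is ?second)
proof -
  have k: "0 < k" "k < 1" "\<kappa> = k / (1 - k)" "1 + \<kappa> = 1 / (1 - k)"
    using assms(1) by (simp_all add: k_def field_simps)
  have l: "0 < l" "l < 1" "lam = l / (1 - l)" "1 + lam = 1 / (1 - l)"
    using assms(2) by (simp_all add: l_def field_simps)
  have m: "0 < m" "m < 1" "\<mu> = m / (1 - m)" "1 + \<mu> = 1 / (1 - m)"
    using assms(3) by (simp_all add: m_def field_simps)
  have n: "0 < n" "n < 1" "\<nu> = n / (1 - n)" "1 + \<nu> = 1 / (1 - n)"
    using assms(4) by (simp_all add: n_def field_simps)
  have ne: "k \<noteq> 0" "1 - k \<noteq> 0" "l \<noteq> 0" "1 - l \<noteq> 0" "m \<noteq> 0" "1 - m \<noteq> 0" "n \<noteq> 0" "1 - n \<noteq> 0"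
    using k l m n by simp_all
  \<comment> \<open>Each factor of the formula becomes a factor of \<open>orient_crossings\<close>
    over a monomial in \<open>l\<close>, \<open>n\<close>, \<open>1 - k\<close>,
    \<open>1 - m\<close>; these monomials cancel in both quotients.\<close>
  have f1: "\<mu> / (1 + \<nu>) + (1 + \<mu>) / lam = (1 - l + l * m - l * m * n) / (l * (1 - m))"
    unfolding m(4) n(4) unfolding m(3) l(3) using ne by (simp add: divide_simps) (simp add: algebra_simps)?
  have f2: "1 + \<kappa> / (1 + \<mu>) + (\<kappa> + 1) / (\<nu> * (1 + \<mu>)) = (1 - m + m * n - m * n * k) / (n * (1 - k))"
    unfolding m(4) add.commute[of \<kappa> 1] k(4) unfolding k(3) n(3) using ne
    by (simp add: divide_simps) (simp add: algebra_simps)?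
  have f3: "2 + 1 / lam - 1 / (1 + \<mu>) = (1 + l * m) / l"
    unfolding m(4) unfolding l(3) using ne by (simp add: divide_simps) (simp add: algebra_simps)?
  have f4: "1 + \<mu> + \<nu> * \<mu> / (1 + \<nu>) = (1 + m * n) / (1 - m)"
    unfolding m(4) n(4) unfolding m(3) n(3) using ne by (simp add: divide_simps) (simp add: algebra_simps)?
  have f5: "1 + 2 * \<kappa> + (\<kappa> + 1) / \<nu> = (1 + n * k) / (n * (1 - k))"
    unfolding add.commute[of \<kappa> 1] k(4) unfolding k(3) n(3) using ne
    by (simp add: divide_simps) (simp add: algebra_simps)?
  have f6: "(\<kappa> + 1) / \<nu> + \<kappa> / (1 + lam) = (1 - n + n * k - n * k * l) / (n * (1 - k))"
    unfolding add.commute[of \<kappa> 1] k(4) l(4) unfolding k(3) n(3) using ne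
    by (simp add: divide_simps) (simp add: algebra_simps)?
  have f7: "1 + 1 / lam + \<kappa> / (1 + \<mu>) = (1 - k + k * l - k * l * m) / (l * (1 - k))"
    unfolding m(4) unfolding k(3) l(3) using ne by (simp add: divide_simps) (simp add: algebra_simps)?
  have f8: "1 + \<kappa> + lam * \<kappa> / (1 + lam) = (1 + k * l) / (1 - k)"
    unfolding k(4) l(4) unfolding k(3) l(3) using ne by (simp add: divide_simps) (simp add: algebra_simps)?
  show ?first
    unfolding f1 f2 f3 f4 f5 using ne by simp
  show ?second
    unfolding f6 f7 f3 f8 f5 using ne by simp
qed

text \<open>The sign behind convexity: up to a positive factor this is the step from one crossing to
  the next along a cevian.\<close>

lemma corner_factor_pos:
  fixes k l m :: real
  assumes "0 < k" "k < 1" "0 < l" "0 < m" "m < 1"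
  shows "0 < 1 - k + k * l - k * l * m"
proof -
  have "0 < (1 - k) + (k * l) * (1 - m)" using assms by (intro add_pos_pos) simp_all
  then show ?thesis by (simp add: algebra_simps)
qed

theorem theorem4:
  fixes A B C D K L M N :: "real^2" and \<kappa> lam \<mu> \<nu> :: real
  assumes "\<kappa> > 0" and "lam > 0" and "\<mu> > 0" and "\<nu> > 0"
    and "parallelogram A B C D"
    and "divides_in_ratio K B C \<kappa>"
    and "divides_in_ratio L C D lam"
    and "divides_in_ratio M D A \<mu>"
    and "divides_in_ratio N A B \<nu>"
  shows "\<exists>X Y Z W.
    closed_segment B L \<inter> closed_segment C M = {X} \<and>
    closed_segment C M \<inter> closed_segment D N = {Y} \<and>
    closed_segment D N \<inter> closed_segment A K = {Z} \<and>
    closed_segment A K \<inter> closed_segment B L = {W} \<and>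
    quadrilateral X Y Z W \<and>
    quad_area X Y Z W =
      (1/2 * (((\<mu> / (1 + \<nu>) + (1 + \<mu>) / lam)
               * (1 + \<kappa> / (1 + \<mu>) + (\<kappa> + 1) / (\<nu> * (1 + \<mu>))))
              / ((2 + 1 / lam - 1 / (1 + \<mu>))
                 * (1 + \<mu> + \<nu> * \<mu> / (1 + \<nu>))
                 * (1 + 2 * \<kappa> + (\<kappa> + 1) / \<nu>)))
       + 1/2 * ((((\<kappa> + 1) / \<nu> + \<kappa> / (1 + lam))
               * (1 + 1 / lam + \<kappa> / (1 + \<mu>)))
              / ((2 + 1 / lam - 1 / (1 + \<mu>))
                 * (1 + \<kappa> + lam * \<kappa> / (1 + lam))
                 * (1 + 2 * \<kappa> + (\<kappa> + 1) / \<nu>))))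
      * quad_area A B C D"
proof -
  define b d where "b = B - A" and "d = D - A"
  define k l m n where "k = \<kappa> / (1 + \<kappa>)" and "l = lam / (1 + lam)"
    and "m = \<mu> / (1 + \<mu>)" and "n = \<nu> / (1 + \<nu>)"
  have k: "0 < k" "k < 1" and l: "0 < l" "l < 1" and m: "0 < m" "m < 1" and n: "0 < n" "n < 1"
    using assms(1-4) by (simp_all add: k_def l_def m_def n_def)
  have C: "C = A + b + d" and B: "B = A + b" and D: "D = A + d"
    using parallelogram_opposite_vertex(1)[OF assms(5)] by (simp_all add: b_def d_def)
  \<comment> \<open>The signed area of the parallelogram; it also serves as the orientation sign in
    \<open>convex_quad\<close>.\<close>
  define e where "e = orient 0 b d"
  have "e = orient A B D" by (simp add: e_def orient_def b_def d_def)
  then have e: "e \<noteq> 0" using parallelogram_opposite_vertex(2)[OF assms(5)] by simp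
  \<comment> \<open>Replacing \<open>(b, d)\<close> by \<open>(d, -b)\<close> preserves the
    determinant, so the lemmas on crossings apply at every vertex with the same
    \<open>e\<close>.\<close>
  have rot: "orient 0 d (- b) = e" "orient 0 (- b) (- d) = e" "orient 0 (- d) b = e"
    by (simp_all add: e_def orient_def)
  have K: "K = A + b + k *\<^sub>R d"
    using divides_in_ratio_eq[OF assms(6,1)] by (simp add: B C k_def)
  have L: "L = A + b + d - l *\<^sub>R b"
    using divides_in_ratio_eq[OF assms(7,2)] by (simp add: C D l_def)
  have M: "M = A + d - m *\<^sub>R d"
    using divides_in_ratio_eq[OF assms(8,3)] by (simp add: D m_def)
  have N: "N = A + n *\<^sub>R b"
    using divides_in_ratio_eq[OF assms(9,4)] by (simp add: B n_def)
  define W X Y Z where "W = crossing A b d k l" and "X = crossing (A + b) d (- b) l m"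
    and "Y = crossing (A + b + d) (- b) (- d) m n" and "Z = crossing (A + d) (- d) b n k"
  have W: "closed_segment A K \<inter> closed_segment B L = {W}"
    using cevians_inter[of b d k l A] k l e by (simp add: W_def K L B e_def)
  have X: "closed_segment B L \<inter> closed_segment C M = {X}"
    using cevians_inter[of d "- b" l m "A + b"] l m e rot
    by (simp add: X_def L M B C algebra_simps)
  have Y: "closed_segment C M \<inter> closed_segment D N = {Y}"
    using cevians_inter[of "- b" "- d" m n "A + b + d"] m n e rot
    by (simp add: Y_def M N C D algebra_simps)
  have Z: "closed_segment D N \<inter> closed_segment A K = {Z}"
    using cevians_inter[of "- d" b n k "A + d"] n k e rot
    by (simp add: Z_def N K D algebra_simps)
  \<comment> \<open>Twice the ratio of a corner triangle to the parallelogram; the four corners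
    arise by cyclic shifts of the arguments.\<close>
  define t where "t k l m n = (1 - k + k * l - k * l * m) * (1 - l + l * m - l * m * n)
        / ((1 + k * l) * (1 + l * m) * (1 + m * n))" for k l m n :: real
  have t_pos: "0 < t k l m n" if "0 < k" "k < 1" "0 < l" "l < 1" "0 < m" "m < 1" "0 < n" "n < 1"
    for k l m n :: real
    unfolding t_def using that
    by (intro divide_pos_pos mult_pos_pos corner_factor_pos add_pos_pos) simp_all
  have WXY: "orient W X Y = t k l m n * e"
    using orient_crossings[of k l m n A b d] k l m n by (simp add: W_def X_def Y_def t_def e_def)
  have XYZ: "orient X Y Z = t l m n k * e"
    using orient_crossings[of l m n k "A + b" d "- b"] k l m n rot
    by (simp add: X_def Y_def Z_def t_def)
  have YZW: "orient Y Z W = t m n k l * e"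
    using orient_crossings[of m n k l "A + b + d" "- b" "- d"] k l m n rot
    by (simp add: Y_def Z_def W_def t_def)
  have ZWX: "orient Z W X = t n k l m * e"
    using orient_crossings[of n k l m "A + d" "- d" b] k l m n rot
    by (simp add: Z_def W_def X_def t_def)
  \<comment> \<open>The factor \<open>e\<close> occurs twice, so the sign of \<open>e\<close> does
    not matter.\<close>
  have e_sq: "0 < e * (c * e)" if "0 < c" for c
  proof -
    have "0 < c * e\<^sup>2" using that e by simp
    then show ?thesis by (simp add: power2_eq_square mult.left_commute)
  qed
  have quad: "convex_quad e X Y Z W"
    unfolding convex_quad_def WXY XYZ YZW ZWX using k l m n by (intro conjI e_sq t_pos)
  have "orient A B C = e" "orient B C D = e" "orient C D A = e" "orient D A B = e"
    by (simp_all add: orient_def e_def B C D algebra_simps)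
  moreover from this have "convex_quad e A B C D"
    using e_sq[of 1] by (simp add: convex_quad_def)
  ultimately have area: "quad_area A B C D = \<bar>e\<bar>"
    by (simp add: quad_area_convex_quad)
  \<comment> \<open>The diagonal \<open>X Z\<close> separates the corners at \<open>Y\<close> and
    \<open>W\<close>, whose ratios are the two summands in \<open>area_ratio\<close>.\<close>
  have "quad_area X Y Z W = (1/2 * t l m n k + 1/2 * t n k l m) * \<bar>e\<bar>"
    using t_pos[of l m n k] t_pos[of n k l m] k l m n
    by (simp add: quad_area_convex_quad[OF quad] XYZ ZWX abs_mult algebra_simps)
  then show ?thesis
    using W X Y Z convex_quad_imp_quadrilateral[OF quad]
    unfolding area_ratio[OF assms(1-4), folded k_def l_def m_def n_def] t_def[symmetric] area
    by blast
qed

end
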